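(* Let $\omega = \sqrt{-2}$ and $\mathcal{E}_{-2} = \{ n \in \mathbb{Z}[\omega] : |n|^2 \le 3\}$. For every $n \in \mathbb{Z}[\omega] \setminus \mathcal{E}_{-2}$ there exist nonzero $a,b,c \in \mathbb{Z}[\omega]$ with $\frac{4}{n} = \frac1a + \frac1b + \frac1c$.
   Context: $\mathbb{Z}[\sqrt{-2}]$ is the ring of integers of $\mathbb{Q}(\sqrt{-2})$; for $n = x + y\omega$ with $x,y\in\mathbb{Z}$, $|n|^2 = x^2 + 2y^2$. *)

theory Defs
  imports Complex_Main
begin

(* The principal square root: omega = i * sqrt 2. *)
definition omega :: complex where
  "omega = csqrt (-2)"

definition Z_omega :: "complex set" where
  "Z_omega = {of_int x + of_int y * omega | x y :: int. True}"

definition E_minus2 :: "complex set" where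
  "E_minus2 = {n \<in> Z_omega. (cmod n)\<^sup>2 \<le> 3}"

lemma omega_squared: "omega\<^sup>2 = -2"
  by (simp only: omega_def power2_csqrt)

lemma omega_eq: "omega = Complex 0 (sqrt 2)"
  by (simp add: omega_def complex_eq_iff)

lemma cmod_Z_omega: "(cmod (of_int x + of_int y * omega))\<^sup>2 = of_int (x\<^sup>2 + 2 * y\<^sup>2)"
  by (simp add: omega_eq cmod_power2 power_mult_distrib)

end

theory Submission
  imports Defs
begin

text \<open>
  If \<open>4 m - n = p\<close> then \<open>4 / n = 1 / m + p / (n m)\<close>, and \<open>p / (n m)\<close> is a sum of two unit
  fractions as soon as some divisor \<open>d\<close> of \<open>n m\<close> satisfies \<open>p dvd 1 + d \<noteq> 0\<close>. Up to sign and
  conjugation an odd \<open>n\<close> is congruent to \<open>1\<close>, \<open>1 + omega\<close> or \<open>1 + 2 omega\<close> modulo \<open>4\<close>, so \<open>p\<close>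
  can be taken to be a unit, an associate of the prime \<open>1 + omega\<close> of norm 3, or an associate of
  its square. For the square, the units modulo \<open>p\<close> up to sign form a group of order 3 in which
  \<open>n = 4 m\<close>, hence one of \<open>n\<close>, \<open>m\<close>, \<open>n m\<close> is \<open>1\<close> or \<open>-1\<close> modulo \<open>p\<close>. Common factors
  and even \<open>n\<close> are removed by scaling a solution for a divisor of \<open>n\<close>.
\<close>

section \<open>Coordinates in Z[omega] and symmetries of solvability\<close>

definition zw :: "int \<Rightarrow> int \<Rightarrow> complex" where
  "zw x y = of_int x + of_int y * omega"

definition esum3 :: "complex \<Rightarrow> bool" where
  "esum3 n \<longleftrightarrow> (\<exists>a\<in>Z_omega. \<exists>b\<in>Z_omega. \<exists>c\<in>Z_omega.
     a \<noteq> 0 \<and> b \<noteq> 0 \<and> c \<noteq> 0 \<and> 4 / n = 1 / a + 1 / b + 1 / c)"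

lemma zw_in [simp]: "zw x y \<in> Z_omega"
  by (auto simp: zw_def Z_omega_def)

lemma zw_eq_iff: "zw x y = zw u v \<longleftrightarrow> x = u \<and> y = v"
  by (simp add: zw_def omega_eq complex_eq_iff)

lemma zw_1: "1 = zw 1 0"
  by (simp add: zw_def)

lemma zw_eq_0_iff: "zw x y = 0 \<longleftrightarrow> x = 0 \<and> y = 0"
  using zw_eq_iff[of x y 0 0] by (simp add: zw_def)

lemma zw_add: "zw x y + zw u v = zw (x + u) (y + v)"
  by (simp add: zw_def algebra_simps)

lemma zw_mult: "zw x y * zw u v = zw (x * u - 2 * y * v) (x * v + y * u)"
proof -
  have "zw x y * zw u v = of_int (x * u) + of_int (x * v + y * u) * omega
      + of_int (y * v) * omega\<^sup>2"
    by (simp add: zw_def power2_eq_square algebra_simps)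
  then show ?thesis
    by (simp add: zw_def omega_squared algebra_simps)
qed

lemma Z_omegaE:
  assumes "n \<in> Z_omega"
  obtains x y where "n = zw x y"
  using assms by (auto simp: Z_omega_def zw_def)

lemma Z_omega_mult: "a \<in> Z_omega \<Longrightarrow> b \<in> Z_omega \<Longrightarrow> a * b \<in> Z_omega"
  by (metis Z_omegaE zw_mult zw_in)

lemma cnj_zw: "cnj (zw x y) = zw x (- y)"
  by (simp add: zw_def omega_eq complex_eq_iff)

lemma esum3_mult:
  assumes "esum3 n" "u \<in> Z_omega" "u \<noteq> 0"
  shows "esum3 (n * u)"
proof -
  obtain a b c where abc: "a \<in> Z_omega" "b \<in> Z_omega" "c \<in> Z_omega" "a \<noteq> 0" "b \<noteq> 0" "c \<noteq> 0"
    "4 / n = 1 / a + 1 / b + 1 / c"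
    using assms(1) unfolding esum3_def by blast
  have "4 / (n * u) = (4 / n) / u" by simp
  also have "\<dots> = 1 / (a * u) + 1 / (b * u) + 1 / (c * u)"
    by (simp add: abc(7) add_divide_distrib)
  finally show ?thesis
    unfolding esum3_def using abc assms
    by (intro bexI[of _ "a * u"] bexI[of _ "b * u"] bexI[of _ "c * u"]) (auto simp: Z_omega_mult)
qed

lemma esum3_uminus: "esum3 (zw (- x) (- y)) \<Longrightarrow> esum3 (zw x y)"
  using esum3_mult[of "zw (- x) (- y)" "zw (-1) 0"] by (simp add: zw_mult zw_eq_0_iff)

lemma esum3_cnj:
  assumes "esum3 (zw x (- y))"
  shows "esum3 (zw x y)"
proof -
  obtain a b c where abc: "a \<in> Z_omega" "b \<in> Z_omega" "c \<in> Z_omega" "a \<noteq> 0" "b \<noteq> 0" "c \<noteq> 0"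
    "4 / zw x (- y) = 1 / a + 1 / b + 1 / c"
    using assms unfolding esum3_def by blast
  have "4 / zw x y = cnj (4 / zw x (- y))"
    by (simp add: cnj_zw)
  also have "\<dots> = 1 / cnj a + 1 / cnj b + 1 / cnj c"
    unfolding abc(7) by simp
  finally have eq: "4 / zw x y = 1 / cnj a + 1 / cnj b + 1 / cnj c" .
  have "cnj a \<in> Z_omega" if "a \<in> Z_omega" for a
    using that by (auto elim!: Z_omegaE simp: cnj_zw)
  then show ?thesis
    unfolding esum3_def using abc eq
    by (intro bexI[of _ "cnj a"] bexI[of _ "cnj b"] bexI[of _ "cnj c"]) simp_all
qed

section \<open>The divisor criterion, and moduli of norm 1 and 3\<close>

text \<open>With \<open>e\<close> the cofactor of \<open>d\<close> in \<open>n * m\<close> and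
  \<open>k\<close> that of \<open>p\<close> in \<open>1 + d\<close>, the remainder splits as p/(nm)
  = (1 + d)/(nmk) = 1/(nmk) + 1/(ek). The condition \<open>1 + d \<noteq> 0\<close> keeps
  \<open>k\<close> nonzero.\<close>

lemma esum3I:
  assumes "m \<in> Z_omega" "e \<in> Z_omega" "k \<in> Z_omega" "n \<in> Z_omega"
    and "4 * m - n = p" "d * e = n * m" "1 + d = p * k"
    and "n \<noteq> 0" "m \<noteq> 0" "1 + d \<noteq> 0"
  shows "esum3 n"
proof -
  have nz: "k \<noteq> 0" "e \<noteq> 0" "d \<noteq> 0" "p \<noteq> 0"
    using assms by auto
  have "4 / n - 1 / m = (4 * m - n) / (n * m)"
    using assms(8,9) by (simp add: diff_divide_eq_iff field_simps)
  also have "\<dots> = (1 + d) / (n * m * k)"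
    using assms(5,7,8,9) nz by simp
  also have "\<dots> = 1 / (n * m * k) + d / (d * e * k)"
    by (simp add: add_divide_distrib assms(6))
  also have "\<dots> = 1 / (n * m * k) + 1 / (e * k)"
    using nz by simp
  finally have "4 / n = 1 / m + 1 / (n * m * k) + 1 / (e * k)"
    by (simp add: algebra_simps)
  then show ?thesis
    unfolding esum3_def using assms nz
    by (intro bexI[of _ m] bexI[of _ "n * m * k"] bexI[of _ "e * k"]) (auto simp: Z_omega_mult)
qed

text \<open>Here \<open>p = -1\<close> is a unit, so the congruence on \<open>d\<close> is void and
  \<open>d = n\<close> serves.\<close>

lemma esum3_1_mod_4:
  assumes "(u, v) \<noteq> (0, 0)"
  shows "esum3 (zw (4 * u + 1) (4 * v))"
proof (rule esum3I)
  show "4 * zw u v - zw (4 * u + 1) (4 * v) = zw (-1) 0"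
    by (simp add: zw_def)
  show "zw (4 * u + 1) (4 * v) * zw u v = zw (4 * u + 1) (4 * v) * zw u v" ..
  show "1 + zw (4 * u + 1) (4 * v) = zw (-1) 0 * zw (- 4 * u - 2) (- 4 * v)"
    by (simp add: zw_1 zw_add zw_mult)
  have "4 * u + 1 \<noteq> 0" "4 * u + 2 \<noteq> 0" by presburger+
  then show "zw (4 * u + 1) (4 * v) \<noteq> 0" "1 + zw (4 * u + 1) (4 * v) \<noteq> 0"
    by (simp_all add: zw_1 zw_add zw_eq_0_iff)
  show "zw u v \<noteq> 0"
    using assms by (simp add: zw_eq_0_iff)
qed auto

lemma esum3_1_plus_omega_mod_4:
  assumes "(u, v) \<noteq> (0, 0)"
  shows "esum3 (zw (4 * u + 1) (4 * v + 1))"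
proof (cases "3 dvd u - v")
  case True
  then obtain w where w: "u = v + 3 * w"
    by (metis diff_add_cancel add.commute dvd_def)
  \<comment> \<open>Here 1 + omega divides n, and the quotient 4(v + w) + 1 - 4w omega is 1 modulo
    4.\<close>
  have "(v + w, - w) \<noteq> (0, 0)"
    using assms w by auto
  then have "esum3 (zw (4 * (v + w) + 1) (4 * (- w)) * zw 1 1)"
    by (intro esum3_mult esum3_1_mod_4) (auto simp: zw_eq_0_iff)
  then show ?thesis
    by (simp add: zw_mult w algebra_simps)
next
  case False
  \<comment> \<open>Modulo 1 + omega one has omega = -1, so n = u - v in the residue field of order
    3. The sign \<open>r\<close> has this same residue, which makes \<open>d = - r * n\<close>
    congruent to -1.\<close>
  define r :: int where "r = (if 3 dvd u - v - 1 then 1 else -1)"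
  have "3 dvd 1 - r * (u - v)"
    using False unfolding r_def by (auto, presburger+)
  then obtain w where w: "1 - r * (u - v) = 3 * w" ..
  have r: "r * r = 1" "r = 1 \<or> r = -1" by (auto simp: r_def)
  let ?n = "zw (4 * u + 1) (4 * v + 1)"
  let ?d = "zw (- r * (4 * u + 1)) (- r * (4 * v + 1))"
  let ?a = "1 - r * (4 * u + 1)" and ?b = "- r * (4 * v + 1)"
  have ab: "?a = ?b + 3 * (4 * w - 1)"
    using w by (simp add: algebra_simps)
  show ?thesis
  proof (rule esum3I)
    show "4 * zw u v - ?n = zw (-1) (-1)"
      by (simp add: zw_def algebra_simps)
    show "?d * zw (- r * u) (- r * v) = ?n * zw u v"
      using r(2) by (auto simp: zw_mult algebra_simps)
    show "1 + ?d = zw (-1) (-1) * zw (- ?b - (4 * w - 1)) (4 * w - 1)"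
      using ab by (simp add: zw_1 zw_add zw_mult zw_eq_iff)
    have "4 * u + 1 \<noteq> 0" "4 * v + 1 \<noteq> 0" by presburger+
    then show "?n \<noteq> 0" "1 + ?d \<noteq> 0"
      using r(2) by (auto simp: zw_1 zw_add zw_eq_0_iff)
    show "zw u v \<noteq> 0"
      using assms by (simp add: zw_eq_0_iff)
  qed auto
qed

section \<open>The modulus (1 + omega)^2 of norm 9\<close>

text \<open>Modulo -1 + 2 omega = (1 + omega)^2 the residue ring is Z/9: from 2 omega = 1 follows
  omega = 5, so X + Y omega reduces to X + 5Y.\<close>

lemma minus_1_plus_2_omega_dvd:
  assumes "9 dvd X + 5 * Y"
  shows "\<exists>k\<in>Z_omega. zw X Y = zw (-1) 2 * k"
proof -
  obtain w where w: "X = 9 * w - 5 * Y"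
    using assms by (metis dvd_def add_diff_cancel_right')
  have "zw X Y = zw (-1) 2 * zw (Y - w) (Y - 2 * w)"
    by (simp add: zw_mult w algebra_simps)
  then show ?thesis by auto
qed

text \<open>To be applied with \<open>s\<close> the residue of m, so that 4s and 4s^2 are those of n
  and nm. The last alternative has no sign t because 4s^2 is a square and -1 is not a square modulo
  9.\<close>

lemma unit_mod_9:
  fixes s :: int
  assumes "\<not> 3 dvd s"
  obtains t where "t = 1 \<or> t = -1" "9 dvd 1 + t * (4 * s)"
  | t where "t = 1 \<or> t = -1" "9 dvd 1 + t * s"
  | "9 dvd 1 - 4 * s * s"
proof -
  obtain q i where s: "s = 9 * q + i" "0 \<le> i" "i < 9"
    by (metis mult_div_mod_eq pos_mod_bound pos_mod_sign zero_less_numeral)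
  have "i \<in> {1, 2, 4, 5, 7, 8}"
    using assms s by (auto, presburger)
  then consider "i = 2" | "i = 7" | "i = 1" | "i = 8" | "i = 4" | "i = 5" by auto
  then show thesis
  proof cases
    case 1
    show thesis by (rule that(1)[of 1]) (simp, use s 1 in presburger)
  next
    case 2
    show thesis by (rule that(1)[of "-1"]) (simp, use s 2 in presburger)
  next
    case 3
    show thesis by (rule that(2)[of "-1"]) (simp, use s 3 in presburger)
  next
    case 4
    show thesis by (rule that(2)[of 1]) (simp, use s 4 in presburger)
  next
    case 5
    have "1 - 4 * s * s = 9 * (- 36 * q * q - 32 * q - 7)"
      using s 5 by (simp add: algebra_simps)
    then show thesis by (intro that(3)) (metis dvd_triv_left)
  next
    case 6
    have "1 - 4 * s * s = 9 * (- 36 * q * q - 40 * q - 11)"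
      using s 6 by (simp add: algebra_simps)
    then show thesis by (intro that(3)) (metis dvd_triv_left)
  qed
qed

text \<open>Clearing denominators reduces a concrete solution to a computation in coordinates; 4 is
  written \<open>zw 4 0\<close> so that the rules for \<open>zw\<close> evaluate both sides.\<close>

lemma esum3_witness:
  assumes "a \<in> Z_omega" "b \<in> Z_omega" "c \<in> Z_omega"
    and nz: "a \<noteq> 0" "b \<noteq> 0" "c \<noteq> 0" "n \<noteq> 0"
    and eq: "zw 4 0 * (a * b * c) = (b * c + a * c + a * b) * n"
  shows "esum3 n"
proof -
  have "4 / n = (b * c + a * c + a * b) / (a * b * c)"
    using nz eq by (subst frac_eq_eq) (auto simp: zw_def)
  also have "\<dots> = 1 / a + 1 / b + 1 / c"
    using nz by (simp add: add_divide_distrib)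
  finally show ?thesis
    unfolding esum3_def using assms by blast
qed

text \<open>The values of \<open>n\<close> for which the chosen divisor is \<open>d = -1\<close>, so that \<open>1 + d = 0\<close>.\<close>

lemma esum3_exceptional: "esum3 (zw 5 (-2))" "esum3 (zw (-3) (-2))"
proof -
  show "esum3 (zw 5 (-2))"
    by (rule esum3_witness[of "zw (-2) (-1)" "zw 1 0" "zw (-4) (-5)"])
      (simp_all add: zw_eq_0_iff zw_mult zw_add zw_eq_iff)
  show "esum3 (zw (-3) (-2))"
    by (rule esum3_witness[of "zw (-2) (-1)" "zw (-1) (-1)" "zw (-12) 9"])
      (simp_all add: zw_eq_0_iff zw_mult zw_add zw_eq_iff)
qed

lemma esum3_1_minus_2_omega_mod_4:
  assumes "\<not> 3 dvd u - v"
  shows "esum3 (zw (4 * u + 1) (4 * v - 2))"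
proof -
  let ?n = "zw (4 * u + 1) (4 * v - 2)" and ?m = "zw u v"
  have p: "4 * ?m - ?n = zw (-1) 2"
    by (simp add: zw_def algebra_simps)
  have odd: "4 * u + 1 \<noteq> 0" "4 * v - 2 \<noteq> 0" by presburger+
  have n0: "?n \<noteq> 0" using odd by (simp add: zw_eq_0_iff)
  have m0: "?m \<noteq> 0" using assms by (auto simp: zw_eq_0_iff)
  \<comment> \<open>The criterion for d = X + Y omega with p = -1 + 2 omega: d must divide nm, be -1
    modulo p, and differ from -1.\<close>
  have step: "esum3 ?n"
    if "9 dvd 1 + X + 5 * Y" "zw X Y * e = ?n * ?m" "e \<in> Z_omega" "(X, Y) \<noteq> (-1, 0)" for X Y e
  proof -
    have "9 dvd (1 + X) + 5 * Y" using that(1) by simp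
    then obtain k where k: "k \<in> Z_omega" "zw (1 + X) Y = zw (-1) 2 * k"
      using minus_1_plus_2_omega_dvd by blast
    have eq: "1 + zw X Y = zw (1 + X) Y" by (simp add: zw_1 zw_add)
    have "1 + zw X Y \<noteq> 0" using that(4) by (auto simp: eq zw_eq_0_iff)
    with that p k n0 m0 eq show ?thesis
      by (intro esum3I[of ?m e k ?n "zw (-1) 2" "zw X Y"]) auto
  qed
  \<comment> \<open>The residue u + 5v of m is a unit modulo 9, since it agrees with u - v modulo
    3.\<close>
  have "\<not> 3 dvd u + 5 * v" using assms by presburger
  then consider (n) t where "t = 1 \<or> t = -1" "9 dvd 1 + t * (4 * (u + 5 * v))"
    | (m) t where "t = 1 \<or> t = -1" "9 dvd 1 + t * (u + 5 * v)"
    | (nm) "9 dvd 1 - 4 * (u + 5 * v) * (u + 5 * v)"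
    by (rule unit_mod_9)
  then show ?thesis
  proof cases
    case n
    show ?thesis
    proof (rule step)
      have "1 + t * (4 * u + 1) + 5 * (t * (4 * v - 2)) = (1 + t * (4 * (u + 5 * v))) - 9 * t"
        by (simp add: algebra_simps)
      then show "9 dvd 1 + t * (4 * u + 1) + 5 * (t * (4 * v - 2))"
        using n(2) by (metis dvd_diff dvd_triv_left)
      show "zw (t * (4 * u + 1)) (t * (4 * v - 2)) * zw (t * u) (t * v) = ?n * ?m"
        using n(1) by (auto simp: zw_mult algebra_simps)
      show "(t * (4 * u + 1), t * (4 * v - 2)) \<noteq> (-1, 0)"
        using n(1) odd by auto
    qed simp
  next
    case m
    \<comment> \<open>The divisor d = t m equals -1 only for m = 1 or m = -1, that is, for the two
      exceptional n.\<close>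
    consider "(u, v) = (1, 0)" | "(u, v) = (-1, 0)" | "(t * u, t * v) \<noteq> (-1, 0)"
      using m(1) by fastforce
    then show ?thesis
    proof cases
      case 3
      show ?thesis
      proof (rule step)
        show "9 dvd 1 + t * u + 5 * (t * v)"
          using m(2) by (simp add: algebra_simps)
        show "zw (t * u) (t * v) * zw (t * (4 * u + 1)) (t * (4 * v - 2)) = ?n * ?m"
          using m(1) by (auto simp: zw_mult algebra_simps)
      qed (use 3 in auto)
    qed (use esum3_exceptional in auto)
  next
    case nm
    let ?X = "(4 * u + 1) * u - 2 * (4 * v - 2) * v" and ?Y = "(4 * u + 1) * v + (4 * v - 2) * u"
    have prod: "?n * ?m = zw ?X ?Y" by (simp add: zw_mult)
    show ?thesis
    proof (rule step)
      have "1 + (- ?X) + 5 * (- ?Y)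
          = (1 - 4 * (u + 5 * v) * (u + 5 * v)) + 9 * (u + 5 * v + 3 * (4 * v - 2) * v)"
        by (simp add: algebra_simps)
      then show "9 dvd 1 + (- ?X) + 5 * (- ?Y)"
        using nm by (metis dvd_add dvd_triv_left)
      show "zw (- ?X) (- ?Y) * zw (-1) 0 = ?n * ?m"
        by (simp add: zw_mult zw_eq_iff)
      show "(- ?X, - ?Y) \<noteq> (-1, 0)"
      proof
        \<comment> \<open>If d = -nm were -1, multiplicativity of the norm would give n norm 1, but
          both coordinates of n are nonzero.\<close>
        assume "(- ?X, - ?Y) = (-1, 0)"
        then have "?X = 1" "?Y = 0" by auto
        then have "?X\<^sup>2 + 2 * ?Y\<^sup>2 = 1" by simp
        moreover have "?X\<^sup>2 + 2 * ?Y\<^sup>2 = ((4 * u + 1)\<^sup>2 + 2 * (4 * v - 2)\<^sup>2) * (u\<^sup>2 + 2 * v\<^sup>2)"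
          by algebra
        ultimately have "((4 * u + 1)\<^sup>2 + 2 * (4 * v - 2)\<^sup>2) * (u\<^sup>2 + 2 * v\<^sup>2) = 1" by simp
        then have "(4 * u + 1)\<^sup>2 + 2 * (4 * v - 2)\<^sup>2 = 1"
          by (smt (verit) pos_zmult_eq_1_iff zero_le_power2 mult_eq_0_iff zero_less_mult_iff)
        moreover have "(4 * v - 2)\<^sup>2 > 0" "(4 * u + 1)\<^sup>2 > 0" using odd by simp_all
        ultimately show False by linarith
      qed
    qed simp
  qed
qed

section \<open>Multiples of omega\<close>

text \<open>Base cases for division by omega: the quotients -omega and 1 - omega have norms 2 and 3,
  too small for an induction hypothesis.\<close>

lemma esum3_small_even: "esum3 (zw 2 0)" "esum3 (zw 2 1)"
proof -
  show "esum3 (zw 2 0)"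
    by (rule esum3_witness[of "zw 2 0" "zw 1 0" "zw 2 0"])
      (simp_all add: zw_eq_0_iff zw_mult zw_add zw_eq_iff)
  show "esum3 (zw 2 1)"
    by (rule esum3_witness[of "zw 2 1" "zw 1 0" "zw 0 1"])
      (simp_all add: zw_eq_0_iff zw_mult zw_add zw_eq_iff)
qed

lemma norm_le_3_cases:
  fixes x y :: int
  assumes "x\<^sup>2 + 2 * y\<^sup>2 \<le> 3"
  shows "x \<in> {-1, 0, 1}" "y \<in> {-1, 0, 1}"
proof -
  have "\<bar>x\<bar> \<le> 1" "\<bar>y\<bar> \<le> 1"
  proof -
    have "x\<^sup>2 \<le> 3" "y\<^sup>2 \<le> 1"
      using assms zero_le_power2[of x] zero_le_power2[of y] by linarith+
    then have "\<bar>x\<bar>\<^sup>2 < 2\<^sup>2" "\<bar>y\<bar>\<^sup>2 < 2\<^sup>2" by simp_all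
    then show "\<bar>x\<bar> \<le> 1" "\<bar>y\<bar> \<le> 1"
      using power_less_imp_less_base[of "\<bar>x\<bar>" 2 2] power_less_imp_less_base[of "\<bar>y\<bar>" 2 2] by auto
  qed
  then show "x \<in> {-1, 0, 1}" "y \<in> {-1, 0, 1}" by auto
qed

text \<open>Descent along 2w + y omega = omega (y - w omega). If the quotient has norm at most 3,
  only 2, 2 + omega and their images under sign and conjugation remain.\<close>

lemma esum3_even:
  assumes IH: "y\<^sup>2 + 2 * w\<^sup>2 > 3 \<Longrightarrow> esum3 (zw y (- w))"
    and big: "(2 * w)\<^sup>2 + 2 * y\<^sup>2 > 3"
  shows "esum3 (zw (2 * w) y)"
proof (cases "y\<^sup>2 + 2 * w\<^sup>2 > 3")
  case True
  then have "esum3 (zw y (- w) * zw 0 1)"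
    by (intro esum3_mult IH) (auto simp: zw_eq_0_iff)
  then show ?thesis by (simp add: zw_mult)
next
  case False
  then have yw: "y \<in> {-1, 0, 1}" "w \<in> {-1, 0, 1}"
    using norm_le_3_cases[of y w] by auto
  have "esum3 (zw 2 (-1))"
    by (rule esum3_cnj) (simp add: esum3_small_even)
  then have two: "esum3 (zw 2 z)" if "z \<in> {-1, 0, 1}" for z
    using that esum3_small_even by auto
  have "w = 1 \<or> w = -1" using big yw by auto
  then show ?thesis
  proof
    assume "w = 1"
    then show ?thesis using two[of y] yw by simp
  next
    assume "w = -1"
    moreover have "esum3 (zw 2 (- y))" using yw(1) by (intro two) auto
    ultimately show ?thesis by (simp add: esum3_uminus)
  qed
qed

section \<open>Odd real part, and induction on the norm\<close>

lemma esum3_1_mod_2: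
  assumes IH: "\<And>a b. x = 3 * a \<Longrightarrow> y = 3 * b \<Longrightarrow> a\<^sup>2 + 2 * b\<^sup>2 > 3 \<Longrightarrow> esum3 (zw a b)"
    and big: "x\<^sup>2 + 2 * y\<^sup>2 > 3" and x: "x mod 4 = 1"
  shows "esum3 (zw x y)"
proof -
  define u where "u = x div 4"
  have xu: "x = 4 * u + 1" unfolding u_def using x by presburger
  consider v where "y = 4 * v" | v where "y = 4 * v + 1" | v where "y = - (4 * v + 1)"
    | v where "y = 4 * v - 2"
  proof -
    have "\<exists>v. y = 4 * v \<or> y = 4 * v + 1 \<or> y = - (4 * v + 1) \<or> y = 4 * v - 2" by presburger
    then show thesis using that by blast
  qed
  then show ?thesis
  proof cases
    case (1 v)
    have "(u, v) \<noteq> (0, 0)" using 1 xu big by auto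
    then show ?thesis
      using esum3_1_mod_4[of u v] 1 by (simp add: xu)
  next
    case (2 v)
    have "(u, v) \<noteq> (0, 0)" using 2 xu big by auto
    then show ?thesis
      using esum3_1_plus_omega_mod_4[of u v] 2 by (simp add: xu)
  next
    case (3 v)
    have "(u, v) \<noteq> (0, 0)" using 3 xu big by auto
    then show ?thesis
      using esum3_1_plus_omega_mod_4[of u v] 3 esum3_cnj[of x y] by (simp add: xu add.commute)
  next
    case (4 v)
    \<comment> \<open>Either n or its conjugate is prime to 1 + omega, or both 1 + omega and 1 -
      omega divide n, and then 3 does.\<close>
    consider "\<not> 3 dvd x - y" | "\<not> 3 dvd x + y" | a b where "x = 3 * a" "y = 3 * b"
    proof -
      have "\<exists>a b. x = 3 * a \<and> y = 3 * b" if "3 dvd x - y" "3 dvd x + y"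
      proof -
        have "3 dvd x" "3 dvd y" using that by presburger+
        then show ?thesis by (auto simp: dvd_def)
      qed
      then show thesis using that by blast
    qed
    then show ?thesis
    proof cases
      case 1
      then have "\<not> 3 dvd u - v" using xu 4 by presburger
      then show ?thesis
        using esum3_1_minus_2_omega_mod_4 xu 4 by simp
    next
      case 2
      then have "\<not> 3 dvd u - (1 - v)" using xu 4 by presburger
      then have "esum3 (zw (4 * u + 1) (4 * (1 - v) - 2))"
        by (rule esum3_1_minus_2_omega_mod_4)
      moreover have "4 * (1 - v) - 2 = - y" using 4 by simp
      ultimately show ?thesis
        using esum3_cnj[of x y] by (simp add: xu)
    next
      case (3 a b)
      \<comment> \<open>Since 3b = y is 2 modulo 4, so is b; hence n/3 is still outside the
        exceptional set.\<close>
      have "b \<noteq> -1 \<and> b \<noteq> 0 \<and> b \<noteq> 1" using 3 4 by presburger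
      then have "a\<^sup>2 + 2 * b\<^sup>2 > 3"
        using norm_le_3_cases(2)[of a b] by force
      then have "esum3 (zw a b * zw 3 0)"
        using IH 3 by (intro esum3_mult) (auto simp: zw_eq_0_iff)
      then show ?thesis using 3 by (simp add: zw_mult mult.commute)
    qed
  qed
qed

lemma esum3_zw: "x\<^sup>2 + 2 * y\<^sup>2 > 3 \<Longrightarrow> esum3 (zw x y)"
proof (induction "nat (x\<^sup>2 + 2 * y\<^sup>2)" arbitrary: x y rule: less_induct)
  case less
  have IH: "esum3 (zw a b)" if "a\<^sup>2 + 2 * b\<^sup>2 < x\<^sup>2 + 2 * y\<^sup>2" "a\<^sup>2 + 2 * b\<^sup>2 > 3" for a b
    using that less.hyps[of a b] by simp
  \<comment> \<open>Stated through squares so that it serves both n and -n.\<close>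
  have IH3: "esum3 (zw a b)" if "x\<^sup>2 = (3 * a)\<^sup>2" "y\<^sup>2 = (3 * b)\<^sup>2" "a\<^sup>2 + 2 * b\<^sup>2 > 3" for a b
    using that by (intro IH) (auto simp: power_mult_distrib)
  consider w where "x = 2 * w" | "x mod 4 = 1" | "(- x) mod 4 = 1"
  proof -
    have "(\<exists>w. x = 2 * w) \<or> x mod 4 = 1 \<or> (- x) mod 4 = 1" by presburger
    then show thesis using that by blast
  qed
  then show ?case
  proof cases
    case (1 w)
    have "esum3 (zw y (- w))" if "y\<^sup>2 + 2 * w\<^sup>2 > 3"
      using that 1 by (intro IH) (auto simp: power_mult_distrib)
    then show ?thesis
      using esum3_even less.prems 1 by simp
  next
    case 2
    show ?thesis
    proof (rule esum3_1_mod_2)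
      show "esum3 (zw a b)" if "x = 3 * a" "y = 3 * b" "a\<^sup>2 + 2 * b\<^sup>2 > 3" for a b
        using that by (intro IH3) simp_all
    qed (use less.prems 2 in auto)
  next
    case 3
    have "esum3 (zw (- x) (- y))"
    proof (rule esum3_1_mod_2)
      show "esum3 (zw a b)" if "- x = 3 * a" "- y = 3 * b" "a\<^sup>2 + 2 * b\<^sup>2 > 3" for a b
        using that(3) that(1,2)[symmetric] by (intro IH3) simp_all
    qed (use less.prems 3 in auto)
    then show ?thesis by (rule esum3_uminus)
  qed
qed

theorem theorem11:
  fixes n :: complex
  assumes "n \<in> Z_omega - E_minus2"
  shows "\<exists>a\<in>Z_omega. \<exists>b\<in>Z_omega. \<exists>c\<in>Z_omega.
           a \<noteq> 0 \<and> b \<noteq> 0 \<and> c \<noteq> 0 \<and> 4 / n = 1 / a + 1 / b + 1 / c"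
proof -
  obtain x y where n: "n = zw x y"
    using assms Z_omegaE by blast
  have "\<not> real_of_int (x\<^sup>2 + 2 * y\<^sup>2) \<le> 3"
    using assms cmod_Z_omega[of x y] by (simp add: E_minus2_def n zw_def)
  then have "x\<^sup>2 + 2 * y\<^sup>2 > 3" by linarith
  then show ?thesis
    using esum3_zw n esum3_def by blast
qed

end
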